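(* Let $\rho_1,\rho_2>0$ and let $(M,\omega,F=(L,H))$ be the coupled spin-oscillator on $M=\mathbb{S}^2\times\mathbb{R}^2$ with $\omega=\rho_1\omega_{\mathbb{S}^2}\oplus\rho_2\omega_{\mathbb{R}^2}$. Then every fiber of $F$ is displaceable.
   Context: $\omega_{\mathbb{S}^2}$ and $\omega_{\mathbb{R}^2}$ are the standard symplectic forms on the unit sphere and on the plane. With Cartesian coordinates $(x,y,z)$ on $\mathbb{S}^2\subset\mathbb{R}^3$ and $(u,v)$ on $\mathbb{R}^2$, the coupled spin-oscillator is given by $$L(x,y,z,u,v)=\rho_1z+\rho_2\frac{u^2+v^2}{2},\qquad H(x,y,z,u,v)=\frac{xu+yv}{2}.$$ A subset $X\subset M$ is displaceable if there is a smooth compactly supported time-dependent Hamiltonian $G:[0,1]\times M\to\mathbb{R}$ whose time-one map $\phi^1_G$ satisfies $\phi^1_G(X)\cap\overline{X}=\emptyset$. *)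

theory Defs
  imports "HOL-Analysis.Analysis"
begin

section \<open>Smooth functions on subsets of Euclidean space\<close>

primrec k_times_differentiable_on ::
    "nat \<Rightarrow> ('a::real_normed_vector \<Rightarrow> 'b::real_normed_vector) \<Rightarrow> 'a set \<Rightarrow> bool" where
  "k_times_differentiable_on 0 f U \<longleftrightarrow> continuous_on U f"
| "k_times_differentiable_on (Suc k) f U \<longleftrightarrow>
     (\<forall>x\<in>U. f differentiable (at x)) \<and>
     (\<forall>v. k_times_differentiable_on k (\<lambda>x. frechet_derivative f (at x) v) U)"

text \<open>Smoothness on an arbitrary set means that locally there is a smooth extension to an
  open subset of the ambient space. For an embedded submanifold, possibly with boundary,
  this is the usual notion.\<close>

definition smooth_on ::
    "'a::real_normed_vector set \<Rightarrow> ('a \<Rightarrow> 'b::real_normed_vector) \<Rightarrow> bool" where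
  "smooth_on S f \<longleftrightarrow>
     (\<forall>x\<in>S. \<exists>U g. open U \<and> x \<in> U \<and> (\<forall>k. k_times_differentiable_on k g U) \<and>
                 (\<forall>y\<in>S \<inter> U. g y = f y))"


section \<open>The symplectic manifold\<close>

type_synonym point = "(real^3) \<times> (real^2)"

definition M :: "point set" where
  "M = sphere 0 1 \<times> UNIV"

definition tangent_space :: "point \<Rightarrow> point set" where
  "tangent_space p = {X. fst p \<bullet> fst X = 0}"

text \<open>The standard area form of the unit sphere is oriented as \<open>dz \<and> d\<theta>\<close> in cylindrical
  coordinates, matching \<open>du \<and> dv = d(r\<^sup>2/2) \<and> d\<theta>\<close> on the plane. With the form on the plane
  fixed as \<open>du \<and> dv\<close>, this is the orientation for which \<open>L\<close> and \<open>H\<close> Poisson commute,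
  see \<open>L_H_commute\<close> below.\<close>

definition \<omega>_sphere :: "real^3 \<Rightarrow> real^3 \<Rightarrow> real^3 \<Rightarrow> real" where
  "\<omega>_sphere q a b = - (q \<bullet> cross3 a b)"

definition \<omega>_plane :: "real^2 \<Rightarrow> real^2 \<Rightarrow> real" where
  "\<omega>_plane a b = a$1 * b$2 - a$2 * b$1"

definition \<omega> :: "real \<Rightarrow> real \<Rightarrow> point \<Rightarrow> point \<Rightarrow> point \<Rightarrow> real" where
  "\<omega> \<rho>1 \<rho>2 p X Y =
     \<rho>1 * \<omega>_sphere (fst p) (fst X) (fst Y) + \<rho>2 * \<omega>_plane (snd X) (snd Y)"


section \<open>Hamiltonian flows and displaceability\<close>

text \<open>\<open>X\<close> is the value at \<open>p\<close> of the Hamiltonian vector field of \<open>g\<close> with respect to the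
  form \<open>\<sigma>\<close>, with the convention that contracting \<open>\<sigma>\<close> with it gives \<open>dg\<close>. (The opposite
  convention amounts to replacing \<open>g\<close> by \<open>-g\<close>.) The derivative of \<open>g\<close> within \<open>M\<close> is
  determined only on tangent vectors, which is all that is used.\<close>

definition hamiltonian_vector ::
    "(point \<Rightarrow> point \<Rightarrow> point \<Rightarrow> real) \<Rightarrow> (point \<Rightarrow> real) \<Rightarrow> point \<Rightarrow> point \<Rightarrow> bool" where
  "hamiltonian_vector \<sigma> g p X \<longleftrightarrow>
     X \<in> tangent_space p \<and>
     (\<exists>D. (g has_derivative D) (at p within M) \<and> (\<forall>Y\<in>tangent_space p. \<sigma> p X Y = D Y))"

definition smooth_compactly_supported :: "(real \<Rightarrow> point \<Rightarrow> real) \<Rightarrow> bool" where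
  "smooth_compactly_supported G \<longleftrightarrow>
     smooth_on ({0..1} \<times> M) (\<lambda>(t, p). G t p) \<and>
     compact (closure {(t, p). t \<in> {0..1} \<and> p \<in> M \<and> G t p \<noteq> 0})"

definition hamiltonian_flow ::
    "(point \<Rightarrow> point \<Rightarrow> point \<Rightarrow> real) \<Rightarrow> (real \<Rightarrow> point \<Rightarrow> real) \<Rightarrow>
     (real \<Rightarrow> point \<Rightarrow> point) \<Rightarrow> bool" where
  "hamiltonian_flow \<sigma> G \<phi> \<longleftrightarrow>
     (\<forall>p\<in>M. \<phi> 0 p = p \<and>
        (\<forall>t\<in>{0..1}. \<phi> t p \<in> M \<and>
           (\<exists>X. hamiltonian_vector \<sigma> (G t) (\<phi> t p) X \<and>
                ((\<lambda>s. \<phi> s p) has_vector_derivative X) (at t within {0..1}))))"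

text \<open>On \<open>M\<close> and for times in \<open>[0,1]\<close> the flow of \<open>G\<close> is uniquely determined, so \<open>\<phi> 1\<close> below
  is the time-one map. Since \<open>M\<close> is closed in the ambient space, the closure of a subset
  of \<open>M\<close> may be taken there.\<close>

definition displaceable :: "(point \<Rightarrow> point \<Rightarrow> point \<Rightarrow> real) \<Rightarrow> point set \<Rightarrow> bool" where
  "displaceable \<sigma> X \<longleftrightarrow>
     X \<subseteq> M \<and>
     (\<exists>G \<phi>. smooth_compactly_supported G \<and> hamiltonian_flow \<sigma> G \<phi> \<and>
            \<phi> 1 ` X \<inter> closure X = {})"


section \<open>The coupled spin-oscillator\<close>

definition L :: "real \<Rightarrow> real \<Rightarrow> point \<Rightarrow> real" where
  "L \<rho>1 \<rho>2 p = \<rho>1 * fst p $ 3 + \<rho>2 * (((snd p $ 1)\<^sup>2 + (snd p $ 2)\<^sup>2) / 2)"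

definition H :: "point \<Rightarrow> real" where
  "H p = (fst p $ 1 * snd p $ 1 + fst p $ 2 * snd p $ 2) / 2"

definition F :: "real \<Rightarrow> real \<Rightarrow> point \<Rightarrow> real \<times> real" where
  "F \<rho>1 \<rho>2 p = (L \<rho>1 \<rho>2 p, H p)"

definition fiber :: "real \<Rightarrow> real \<Rightarrow> real \<times> real \<Rightarrow> point set" where
  "fiber \<rho>1 \<rho>2 c = {p \<in> M. F \<rho>1 \<rho>2 p = c}"

lemma hamiltonian_vector_L:
  assumes "p \<in> M"
  shows "hamiltonian_vector (\<omega> \<rho>1 \<rho>2) (L \<rho>1 \<rho>2) p
           (vector [fst p $ 2, - fst p $ 1, 0], vector [snd p $ 2, - snd p $ 1])"
proof -
  let ?D = "\<lambda>Y::point. \<rho>1 * fst Y $ 3 + \<rho>2 * (snd p $ 1 * snd Y $ 1 + snd p $ 2 * snd Y $ 2)"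
  have "(L \<rho>1 \<rho>2 has_derivative ?D) (at p within M)"
    unfolding L_def by (auto intro!: derivative_eq_intros bounded_linear.has_derivative[OF bounded_linear_vec_nth]
        simp: algebra_simps)
  moreover have "\<omega> \<rho>1 \<rho>2 p (vector [fst p $ 2, - fst p $ 1, 0], vector [snd p $ 2, - snd p $ 1]) Y = ?D Y"
    if "Y \<in> tangent_space p" for Y
  proof -
    obtain q w where p: "p = (q, w)" by (cases p)
    obtain a b where Y: "Y = (a, b)" by (cases Y)
    have n: "(q$1)\<^sup>2 + (q$2)\<^sup>2 + (q$3)\<^sup>2 = 1"
      using assms by (simp add: p M_def norm_eq_1 inner_vec_def sum_3 power2_eq_square)
    have t: "q$1 * a$1 + q$2 * a$2 + q$3 * a$3 = 0"
      using that by (simp add: p Y tangent_space_def inner_vec_def sum_3)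
    have "\<omega>_sphere q (vector [q$2, - q$1, 0]) a =
        a$3 * ((q$1)\<^sup>2 + (q$2)\<^sup>2 + (q$3)\<^sup>2) - q$3 * (q$1 * a$1 + q$2 * a$2 + q$3 * a$3)"
      by (simp add: \<omega>_sphere_def cross3_def inner_vec_def sum_3 power2_eq_square algebra_simps)
    also have "\<dots> = a$3"
      unfolding n t by simp
    finally show ?thesis
      by (simp add: p Y \<omega>_def \<omega>_plane_def algebra_simps)
  qed
  ultimately show ?thesis
    by (auto simp: hamiltonian_vector_def tangent_space_def inner_vec_def sum_3)
qed

lemma L_H_commute:
  assumes "(H has_derivative D) (at p)"
  shows "D (vector [fst p $ 2, - fst p $ 1, 0], vector [snd p $ 2, - snd p $ 1]) = 0"
proof -
  have "(H has_derivative (\<lambda>Y::point. (fst p $ 1 * snd Y $ 1 + fst Y $ 1 * snd p $ 1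
          + (fst p $ 2 * snd Y $ 2 + fst Y $ 2 * snd p $ 2)) / 2)) (at p)"
    unfolding H_def by (auto intro!: derivative_eq_intros bounded_linear.has_derivative[OF bounded_linear_vec_nth]
        simp: algebra_simps)
  from has_derivative_unique[OF assms this] show ?thesis
    by (simp add: algebra_simps)
qed

end

theory Submission
  imports Defs
begin

text \<open>A level set of \<open>L\<close> is bounded in the plane direction, and every bounded subset of \<open>M\<close> is
  displaceable by a Hamiltonian on the plane alone. A radial Hamiltonian about a point \<open>c\<close> has an
  explicit flow: it rotates each circle about \<open>c\<close> by an angle depending only on the radius. If the
  cutoff profile is scaled to the distance of \<open>c\<close> from the origin and this distance is large, a fixed
  disc meets only circles of nearly equal relative radius, so it is turned about \<open>c\<close> by
  nearly \<open>\<pi>\<close>, away from itself.\<close>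

section \<open>Smooth cutoffs built from \<open>exp (- 1 / x)\<close>\<close>

definition flat :: "nat \<Rightarrow> real \<Rightarrow> real" where
  "flat n x = (if x \<le> 0 then 0 else inverse x ^ n / exp (inverse x))"

text \<open>On the right, \<open>inverse x\<close> tends to infinity and the exponential dominates
  every power.\<close>

lemma tendsto_flat_0: "(flat n \<longlongrightarrow> 0) (at 0)"
proof (rule filterlim_split_at)
  show "(flat n \<longlongrightarrow> 0) (at_left 0)"
    by (rule tendsto_eventually) (auto simp: flat_def eventually_at_filter)
  have "((\<lambda>x. inverse x ^ n / exp (inverse x)) \<longlongrightarrow> 0) (at_right (0::real))"
    using filterlim_compose[OF tendsto_power_div_exp_0 filterlim_inverse_at_top_right] .
  then show "(flat n \<longlongrightarrow> 0) (at_right 0)"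
    by (rule Lim_transform_eventually) (auto simp: flat_def eventually_at_filter)
qed

text \<open>The index counts powers of \<open>inverse x\<close>. Differentiation only raises it, so
  linear combinations of these functions are closed under derivatives.\<close>

lemma flat_has_real_derivative:
  "(flat n has_real_derivative flat (n + 2) x - real n * flat (n + 1) x) (at x)"
proof (cases x "0::real" rule: linorder_cases)
  case less
  have "((\<lambda>_. 0) has_real_derivative 0) (at x)" by simp
  then have "(flat n has_real_derivative 0) (at x)"
    by (rule has_field_derivative_transform_within_open[where S = "{..<0}"])
      (use less in \<open>auto simp: flat_def\<close>)
  then show ?thesis using less by (simp add: flat_def)
next
  case equal
  \<comment> \<open>The difference quotient at 0 is again a flat function, of index
    \<open>Suc n\<close>.\<close>
  have "((\<lambda>h. (flat n (0 + h) - flat n 0) / h) \<longlongrightarrow> 0) (at 0)"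
    using tendsto_flat_0[of "Suc n"]
    by (rule Lim_transform_eventually) (auto simp: flat_def eventually_at_filter field_simps)
  then show ?thesis using equal by (simp add: DERIV_def flat_def)
next
  case greater
  have "((\<lambda>y. y ^ n / exp y) has_real_derivative (real n * y ^ (n - 1) - y ^ n) / exp y) (at y)"
    for y :: real
    by (auto intro!: derivative_eq_intros simp: field_simps)
  from DERIV_chain2[OF this DERIV_inverse] greater
  have "((\<lambda>x. inverse x ^ n / exp (inverse x)) has_real_derivative
      (real n * inverse x ^ (n - 1) - inverse x ^ n) / exp (inverse x)
        * - (inverse x ^ Suc (Suc 0))) (at x)"
    by simp
  \<comment> \<open>\<open>n - 1\<close> truncates at \<open>n = 0\<close>, where the coefficient
    \<open>real n\<close> vanishes; hence the case split.\<close>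
  also have "(real n * y ^ (n - 1) - y ^ n) / e * - (y ^ Suc (Suc 0))
      = y ^ (n + 2) / e - real n * (y ^ (n + 1) / e)" for y e :: real
    by (cases n) (simp_all add: add_divide_distrib diff_divide_distrib algebra_simps)
  also have "inverse x ^ (n + 2) / exp (inverse x) - real n * (inverse x ^ (n + 1) / exp (inverse x))
      = flat (n + 2) x - real n * flat (n + 1) x"
    using greater by (simp add: flat_def)
  finally have "((\<lambda>x. inverse x ^ n / exp (inverse x)) has_real_derivative
      flat (n + 2) x - real n * flat (n + 1) x) (at x)" .
  then show ?thesis
    by (rule has_field_derivative_transform_within_open[where S = "{0<..}"])
      (use greater in \<open>auto simp: flat_def\<close>)
qed

text \<open>A class of functions that is visibly closed under directional derivatives, and hence consists
  of smooth functions.\<close>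

inductive flat_polynomial :: "('a::real_normed_vector \<Rightarrow> real) \<Rightarrow> bool" where
  const: "flat_polynomial (\<lambda>_. c)"
| linear: "bounded_linear f \<Longrightarrow> flat_polynomial f"
| add: "flat_polynomial f \<Longrightarrow> flat_polynomial g \<Longrightarrow> flat_polynomial (\<lambda>x. f x + g x)"
| mult: "flat_polynomial f \<Longrightarrow> flat_polynomial g \<Longrightarrow> flat_polynomial (\<lambda>x. f x * g x)"
| flat: "flat_polynomial f \<Longrightarrow> flat_polynomial (\<lambda>x. flat n (f x))"

text \<open>The sum, product and chain rules stay inside the class. Fixing the direction
  \<open>v\<close> keeps derivatives real-valued, so the result can be iterated.\<close>

lemma flat_polynomial_has_derivative:
  assumes "flat_polynomial f"
  shows "\<exists>f'. (\<forall>x. (f has_derivative f' x) (at x)) \<and> (\<forall>v. flat_polynomial (\<lambda>x. f' x v))"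
  using assms
proof induction
  case (const c)
  show ?case
    by (rule exI[of _ "\<lambda>_ _. 0"]) (auto intro: flat_polynomial.const)
next
  case (linear f)
  then show ?case
    by (intro exI[of _ "\<lambda>_. f"]) (auto intro: flat_polynomial.const bounded_linear_imp_has_derivative)
next
  case (add f g)
  then obtain f' g' where
    "\<And>x. (f has_derivative f' x) (at x)" "\<And>v. flat_polynomial (\<lambda>x. f' x v)"
    "\<And>x. (g has_derivative g' x) (at x)" "\<And>v. flat_polynomial (\<lambda>x. g' x v)"
    by metis
  then show ?case
    by (intro exI[of _ "\<lambda>x v. f' x v + g' x v"])
      (auto intro: flat_polynomial.add has_derivative_add)
next
  case (mult f g)
  then obtain f' g' where
    "\<And>x. (f has_derivative f' x) (at x)" "\<And>v. flat_polynomial (\<lambda>x. f' x v)"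
    "\<And>x. (g has_derivative g' x) (at x)" "\<And>v. flat_polynomial (\<lambda>x. g' x v)"
    by metis
  with mult.hyps show ?case
    by (intro exI[of _ "\<lambda>x v. f x * g' x v + f' x v * g x"])
      (auto intro!: flat_polynomial.add flat_polynomial.mult[of f] flat_polynomial.mult[of _ g]
        has_derivative_mult)
next
  case (flat f n)
  then obtain f' where f':
    "\<And>x. (f has_derivative f' x) (at x)" "\<And>v. flat_polynomial (\<lambda>x. f' x v)"
    by metis
  let ?D = "\<lambda>x v. f' x v * (flat (n + 2) (f x) + (- real n) * flat (n + 1) (f x))"
  have "((\<lambda>x. flat n (f x)) has_derivative ?D x) (at x)" for x
    using DERIV_compose_FDERIV[OF flat_has_real_derivative f'(1)] by simp
  moreover have "flat_polynomial (\<lambda>x. ?D x v)" for v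
    by (intro flat_polynomial.mult flat_polynomial.add flat_polynomial.const
        flat_polynomial.flat f'(2) flat.hyps)
  ultimately show ?case by (intro exI[of _ ?D]) blast
qed

lemma flat_polynomial_k_times_differentiable_on:
  "flat_polynomial f \<Longrightarrow> k_times_differentiable_on k f U"
proof (induction k arbitrary: f)
  case 0
  then show ?case
    using flat_polynomial_has_derivative[OF 0]
    by (auto intro!: continuous_at_imp_continuous_on dest: has_derivative_continuous)
next
  case (Suc k)
  obtain f' where f': "\<And>x. (f has_derivative f' x) (at x)" "\<And>v. flat_polynomial (\<lambda>x. f' x v)"
    using flat_polynomial_has_derivative[OF Suc.prems] by metis
  have "(\<lambda>x. frechet_derivative f (at x) v) = (\<lambda>x. f' x v)" for v
    using frechet_derivative_at[OF f'(1)] by simp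
  then show ?case
    using Suc.IH f' by (auto simp: differentiable_def)
qed

lemma flat_polynomial_smooth_on: "flat_polynomial f \<Longrightarrow> smooth_on S f"
  unfolding smooth_on_def
  using flat_polynomial_k_times_differentiable_on by blast

section \<open>Rotations of the plane as Hamiltonian motions\<close>

definition J :: "real^2 \<Rightarrow> real^2" where
  "J v = vector [v$2, - v$1]"

text \<open>\<open>J\<close> is a quarter turn; by the last identity it turns gradients into
  Hamiltonian vectors of \<open>\<omega>_plane\<close>.\<close>

lemma J_simps:
  "J (a + b) = J a + J b" "J (r *\<^sub>R a) = r *\<^sub>R J a" "J (J a) = - a"
  "a \<bullet> J a = 0" "J a \<bullet> J a = a \<bullet> a" "\<omega>_plane (r *\<^sub>R J a) b = r * (a \<bullet> b)"
  by (auto simp: J_def vec_eq_iff forall_2 inner_vec_def sum_2 \<omega>_plane_def algebra_simps)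

text \<open>As \<open>J\<close> squares to minus the identity, this is the exponential of \<theta>
  times \<open>J\<close>.\<close>

definition rot :: "real \<Rightarrow> real^2 \<Rightarrow> real^2" where
  "rot \<theta> v = cos \<theta> *\<^sub>R v + sin \<theta> *\<^sub>R J v"

lemma inner_rot: "v \<bullet> rot \<theta> v = cos \<theta> * (v \<bullet> v)"
  by (simp add: rot_def inner_add_right J_simps)

lemma inner_rot_rot: "rot \<theta> v \<bullet> rot \<theta> v = v \<bullet> v"
proof -
  have "rot \<theta> v \<bullet> rot \<theta> v = ((cos \<theta>)\<^sup>2 + (sin \<theta>)\<^sup>2) * (v \<bullet> v)"
    unfolding power2_eq_square distrib_right
    by (simp add: rot_def inner_add_left inner_add_right J_simps inner_commute[of "J v" v] mult.assoc)
  then show ?thesis by simp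
qed

lemma rot_has_vector_derivative:
  "((\<lambda>t. rot (\<alpha> * t) v) has_vector_derivative \<alpha> *\<^sub>R J (rot (\<alpha> * t) v)) (at t within S)"
  unfolding rot_def
  by (auto intro!: derivative_eq_intros simp: J_simps algebra_simps)

section \<open>Displacing bounded sets\<close>

lemma displaceable_bounded:
  assumes "\<rho>2 \<noteq> 0" and "X \<subseteq> M" and "bounded X"
  shows "displaceable (\<omega> \<rho>1 \<rho>2) X"
proof -
  \<comment> \<open>The angle of the time-one map of the Hamiltonian \<open>G\<close> below on the circle of squared radius
    \<open>s * D\<^sup>2\<close> about \<open>c\<close>; the constant makes it \<open>- pi\<close> on the circle through the origin.\<close>
  define ang where "ang s = - pi * exp 1 * flat 2 (2 - s)" for s :: real
  have "isCont ang 1"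
    unfolding ang_def
    by (auto intro!: continuous_intros isCont_o2[OF _ DERIV_isCont[OF flat_has_real_derivative]])
  moreover have "ang 1 = - pi" by (simp add: ang_def flat_def)
  ultimately have "((\<lambda>s. cos (ang s)) \<longlongrightarrow> - 1) (nhds 1)"
    using tendsto_cos[of ang "ang 1" "nhds 1"] tendsto_at_iff_tendsto_nhds[of ang 1]
    by (simp add: isCont_def)
  \<comment> \<open>A negative cosine means more than a quarter turn, which is all the final
    contradiction uses.\<close>
  then have "eventually (\<lambda>s. cos (ang s) < 0) (nhds 1)"
    by (rule order_tendstoD) simp
  then obtain \<delta> where \<delta>: "\<delta> > 0" "\<And>s. \<bar>s - 1\<bar> < \<delta> \<Longrightarrow> cos (ang s) < 0"
    unfolding eventually_nhds_metric dist_real_def by auto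
  obtain R where R: "R > 0" "\<And>p. p \<in> X \<Longrightarrow> norm p \<le> R"
    using \<open>bounded X\<close> unfolding bounded_pos by blast
  \<comment> \<open>Both bounds absorb the error \<open>3 * (D * R)\<close> in \<open>near\<close>:
    the first makes it smaller than \<open>D\<^sup>2\<close>, the second smaller than
    \<open>\<delta> * D\<^sup>2\<close>.\<close>
  define D where "D = max (3 * R + 1) (3 * R / \<delta> + 1)"
  have D: "D > 3 * R" "D > 3 * R / \<delta>" "D > 0" using R(1) by (auto simp: D_def)
  obtain c :: "real^2" where c: "norm c = D"
    using vector_choose_size[of D] D(3) by auto
  define s where "s v = (v \<bullet> v) / D\<^sup>2" for v :: "real^2"
  \<comment> \<open>The chain rule yields a factor \<open>2 / D\<^sup>2\<close>; \<open>K\<close>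
    cancels it and supplies \<open>\<rho>2\<close>, so that the angular velocity is
    \<open>ang\<close>.\<close>
  define K where "K = pi * exp 1 * \<rho>2 * D\<^sup>2 / 2"
  define G where "G t p = K * flat 0 (2 - s (snd p - c))" for t :: real and p :: point
  define \<phi> where "\<phi> t p = (fst p, c + rot (ang (s (snd p - c)) * t) (snd p - c))"
    for t and p :: point

  have "smooth_compactly_supported G"
    unfolding smooth_compactly_supported_def
  proof
    have comp: "flat_polynomial (\<lambda>x::real \<times> point. snd (snd x) $ i)" for i
      by (intro flat_polynomial.linear bounded_linear_compose[OF bounded_linear_vec_nth]
          bounded_linear_compose[OF bounded_linear_snd] bounded_linear_snd)
    \<comment> \<open>The squared distance to \<open>c\<close> is spelled out in coordinates, as a
      polynomial in linear functions, to fit the inductive class.\<close>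
    have "flat_polynomial (\<lambda>x::real \<times> point. K * flat 0 (2 + (- 1 / D\<^sup>2) *
        ((snd (snd x) $ 1 + - c $ 1) * (snd (snd x) $ 1 + - c $ 1) +
         (snd (snd x) $ 2 + - c $ 2) * (snd (snd x) $ 2 + - c $ 2))))"
      by (intro flat_polynomial.add flat_polynomial.mult flat_polynomial.const
          flat_polynomial.flat comp)
    then show "smooth_on ({0..1} \<times> M) (\<lambda>(t, p). G t p)"
      by (rule flat_polynomial_smooth_on[THEN back_subst[of "smooth_on _"]])
        (auto simp: G_def s_def inner_vec_def sum_2)
  next
    \<comment> \<open>The cutoff vanishes once \<open>s\<close> reaches 2, which bounds the support
      in the plane; the sphere factor is compact.\<close>
    have "dist (snd p) c \<le> sqrt 2 * D" if "G t p \<noteq> 0" for t p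
    proof (rule power2_le_imp_le)
      have "s (snd p - c) < 2" using that by (auto simp: G_def flat_def split: if_splits)
      then show "(dist (snd p) c)\<^sup>2 \<le> (sqrt 2 * D)\<^sup>2"
        using D(3)
        by (simp add: s_def dist_norm power2_norm_eq_inner power_mult_distrib field_simps)
    qed (use D(3) in simp)
    then have "{(t, p). t \<in> {0..1} \<and> p \<in> M \<and> G t p \<noteq> 0} \<subseteq>
        {0..1} \<times> (sphere 0 1 \<times> cball c (sqrt 2 * D))"
      by (force simp: M_def dist_commute[of c])
    moreover have "bounded ({0..1::real} \<times> (sphere (0::real^3) 1 \<times> cball c (sqrt 2 * D)))"
      by (intro bounded_Times) auto
    ultimately show "compact (closure {(t, p). t \<in> {0..1} \<and> p \<in> M \<and> G t p \<noteq> 0})"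
      using bounded_subset by (simp add: compact_closure) blast
  qed

  moreover have "hamiltonian_flow (\<omega> \<rho>1 \<rho>2) G \<phi>"
  proof -
    have G': "hamiltonian_vector (\<omega> \<rho>1 \<rho>2) (G t) p
        (0, ang (s (snd p - c)) *\<^sub>R J (snd p - c))" for t p
    proof -
      let ?v = "snd p - c"
      have "(G t has_derivative
          (\<lambda>Y. K * ((- (2 * (?v \<bullet> snd Y)) / D\<^sup>2) * flat 2 (2 - s ?v)))) (at p within M)"
      proof -
        have "((\<lambda>p. snd p - c) has_derivative snd) (at p within M)"
          using has_derivative_diff[OF bounded_linear_imp_has_derivative[OF bounded_linear_snd]
              has_derivative_const] by simp
        then have "((\<lambda>p. 2 - s (snd p - c)) has_derivative
            (\<lambda>Y. 0 - (?v \<bullet> snd Y + snd Y \<bullet> ?v) / D\<^sup>2)) (at p within M)"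
          unfolding s_def
          by (intro has_derivative_diff has_derivative_const has_derivative_inner
              bounded_linear.has_derivative[OF bounded_linear_divide])
        then have "((\<lambda>p. 2 - s (snd p - c)) has_derivative
            (\<lambda>Y. - (2 * (?v \<bullet> snd Y)) / D\<^sup>2)) (at p within M)"
          by (simp add: inner_commute)
        \<comment> \<open>For index 0 the second term of the derivative vanishes, leaving only
          \<open>flat 2\<close>.\<close>
        from DERIV_compose_FDERIV[OF flat_has_real_derivative[of 0] this]
        show ?thesis unfolding G_def
          by (intro has_derivative_mult_right) (simp add: numeral_2_eq_2)
      qed
      moreover have "\<omega> \<rho>1 \<rho>2 p (0, ang (s ?v) *\<^sub>R J ?v) Y
          = K * ((- (2 * (?v \<bullet> snd Y)) / D\<^sup>2) * flat 2 (2 - s ?v))" for Y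
        using D(3) unfolding \<omega>_def snd_conv J_simps by (simp add: \<omega>_sphere_def ang_def K_def)
      ultimately show ?thesis
        by (auto simp: hamiltonian_vector_def tangent_space_def)
    qed
    \<comment> \<open>Rotation preserves the distance to \<open>c\<close>, so the angular velocity
      is constant along each orbit.\<close>
    have "hamiltonian_vector (\<omega> \<rho>1 \<rho>2) (G t) (\<phi> t p)
        (0, ang (s (snd p - c)) *\<^sub>R J (rot (ang (s (snd p - c)) * t) (snd p - c)))" for t p
      using G'[of t "\<phi> t p"] by (simp add: \<phi>_def s_def inner_rot_rot)
    moreover have "((\<lambda>t. \<phi> t p) has_vector_derivative
        (0, ang (s (snd p - c)) *\<^sub>R J (rot (ang (s (snd p - c)) * t) (snd p - c))))
        (at t within {0..1})" for t p
      unfolding \<phi>_def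
      by (intro has_vector_derivative_Pair has_vector_derivative_const
          has_vector_derivative_add[OF has_vector_derivative_const, unfolded add_0_left]
          rot_has_vector_derivative)
    moreover have "\<phi> 0 p = p" for p
      by (simp add: \<phi>_def rot_def)
    moreover have "\<phi> t p \<in> M" if "p \<in> M" for t p
      using that by (auto simp: \<phi>_def M_def)
    ultimately show ?thesis
      unfolding hamiltonian_flow_def by blast
  qed

  moreover have "\<phi> 1 ` X \<inter> closure X = {}"
  proof -
    have snd_X: "norm (snd p) \<le> R" if "p \<in> X" for p
      using R(2)[OF that] norm_snd_le[of "snd p" "fst p"] by simp
    have clos: "norm (snd p) \<le> R" if "p \<in> closure X" for p
    proof -
      have "closure X \<subseteq> {p. norm (snd p) \<le> R}"
        using snd_X
        by (intro closure_minimal closed_Collect_le continuous_intros) blast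
      with that show ?thesis by blast
    qed
    have "\<phi> 1 p \<notin> closure X" if "p \<in> X" for p
    proof
      assume "\<phi> 1 p \<in> closure X"
      define w w' where "w = snd p" and "w' = snd (\<phi> 1 p)"
      have w: "norm w \<le> R" "norm w' \<le> R"
        using snd_X that clos \<open>\<phi> 1 p \<in> closure X\<close> by (auto simp: w_def w'_def)
      \<comment> \<open>Seen from the distant \<open>c\<close>, points of the disc lie in nearly the
        same direction. Taking \<open>y = w\<close> puts \<open>s (w - c)\<close> near 1; taking
        \<open>y = w'\<close> makes the inner product positive.\<close>
      have expand: "(w - c) \<bullet> (y - c) = w \<bullet> y - c \<bullet> w - c \<bullet> y + D\<^sup>2" for y
        by (simp add: c[symmetric] power2_norm_eq_inner inner_diff_left inner_diff_right inner_commute)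
      have near: "\<bar>(w - c) \<bullet> (y - c) - D\<^sup>2\<bar> < 3 * (D * R)" if "norm y \<le> R" for y
      proof -
        have "\<bar>w \<bullet> y\<bar> \<le> R * R"
          using Cauchy_Schwarz_ineq2[of w y] mult_mono[OF w(1) that] R(1) by simp
        moreover have "\<bar>c \<bullet> y\<bar> \<le> D * R" if "norm y \<le> R" for y
          using order_trans[OF Cauchy_Schwarz_ineq2[of c y] mult_left_mono[OF that norm_ge_zero]]
          by (simp add: c)
        from this[OF w(1)] this[OF that] have "\<bar>c \<bullet> w\<bar> \<le> D * R" "\<bar>c \<bullet> y\<bar> \<le> D * R" .
        moreover have "R * R < D * R"
          using D(1) R(1) by simp
        ultimately show ?thesis
          unfolding expand by linarith
      qed
      have "s (w - c) - 1 = ((w - c) \<bullet> (w - c) - D\<^sup>2) / D\<^sup>2"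
        using D(3) by (simp add: s_def diff_divide_distrib)
      then have "\<bar>s (w - c) - 1\<bar> = \<bar>(w - c) \<bullet> (w - c) - D\<^sup>2\<bar> / D\<^sup>2"
        by simp
      also have "\<dots> < 3 * (D * R) / D\<^sup>2"
        using near[OF w(1)] D(3) by (simp add: divide_strict_right_mono)
      also have "\<dots> < \<delta>"
        using D(2,3) \<delta>(1) by (simp add: power2_eq_square field_simps)
      finally have "\<bar>s (w - c) - 1\<bar> < \<delta>" .
      \<comment> \<open>The turn about \<open>c\<close> forces the opposite sign.\<close>
      then have "cos (ang (s (w - c))) * ((w - c) \<bullet> (w - c)) \<le> 0"
        using \<delta>(2) by (simp add: mult_nonpos_nonneg less_imp_le)
      moreover have "w' - c = rot (ang (s (w - c))) (w - c)"
        by (simp add: w'_def w_def \<phi>_def)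
      ultimately have "(w - c) \<bullet> (w' - c) \<le> 0"
        by (simp add: inner_rot)
      moreover have "3 * (D * R) < D\<^sup>2"
        using D(1,3) by (simp add: power2_eq_square)
      then have "(w - c) \<bullet> (w' - c) > 0"
        using near[OF w(2)] by linarith
      ultimately show False by simp
    qed
    then show ?thesis by blast
  qed

  ultimately show ?thesis
    unfolding displaceable_def using \<open>X \<subseteq> M\<close> by blast
qed

section \<open>Boundedness of the fibers\<close>

theorem theorem1p3:
  fixes \<rho>1 \<rho>2 :: real
  assumes "\<rho>1 > 0" and "\<rho>2 > 0"
  shows "\<forall>c. displaceable (\<omega> \<rho>1 \<rho>2) (fiber \<rho>1 \<rho>2 c)"
proof
  fix c :: "real \<times> real"
  obtain l h where c: "c = (l, h)" by (cases c)
  \<comment> \<open>The sphere contributes at least \<open>- \<rho>1\<close> to \<open>L\<close>,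
    leaving at most \<open>l + \<rho>1\<close> for the plane term. If that is negative, so is the
    root, and the ball is empty like the fiber.\<close>
  let ?r = "sqrt (2 * (l + \<rho>1) / \<rho>2)"
  have "fiber \<rho>1 \<rho>2 c \<subseteq> sphere 0 1 \<times> cball 0 ?r"
  proof
    fix p assume p: "p \<in> fiber \<rho>1 \<rho>2 c"
    then have n: "norm (fst p) = 1" and L: "L \<rho>1 \<rho>2 p = l"
      by (auto simp: fiber_def F_def c M_def)
    have "\<bar>fst p $ 3\<bar> \<le> 1" using component_le_norm_cart[of "fst p" 3] n by simp
    then have "\<rho>1 * (fst p $ 3) \<ge> - \<rho>1"
      using mult_left_mono[of "- 1" "fst p $ 3" \<rho>1] \<open>\<rho>1 > 0\<close> by simp
    then have "\<rho>2 * ((norm (snd p))\<^sup>2 / 2) \<le> l + \<rho>1"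
      using L by (simp add: L_def power2_norm_eq_inner inner_vec_def sum_2 flip: power2_eq_square)
    then have "norm (snd p) \<le> ?r"
      using \<open>\<rho>2 > 0\<close> by (intro real_le_rsqrt) (simp add: field_simps)
    with n show "p \<in> sphere 0 1 \<times> cball 0 ?r" by (simp add: mem_Times_iff)
  qed
  then have "bounded (fiber \<rho>1 \<rho>2 c)"
    by (rule bounded_subset[rotated]) (intro bounded_Times bounded_sphere bounded_cball)
  then show "displaceable (\<omega> \<rho>1 \<rho>2) (fiber \<rho>1 \<rho>2 c)"
    using \<open>\<rho>2 > 0\<close> by (intro displaceable_bounded) (auto simp: fiber_def)
qed

end
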